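(* Let $f:2^U\to\mathbb{R}_{\ge 0}$ be submodular (not necessarily monotone), let $U$ ($|U|=n$) be partitioned into $U_1,\dots,U_N$, let $p_1,\dots,p_N\in[0,1]$ with $\sum_j p_j=1$, let $v$ be a budget and $\epsilon>0$. Run the algorithm nonmono-bi (described in the context) on this instance of nonmonotone SMP with budget $v$. Then its output $S$ satisfies $\mathbb{E}[f(S)]\ge (1/e-\epsilon) f(OPT)$ and $|S\cap U_j|\le \frac{2}{\epsilon}p_j v$ for every $j\in[N]$, where $OPT\in\arg\max\{f(T): T\subseteq U,\ |T\cap U_j|\le p_j v\ \forall j\in[N]\}$; moreover the algorithm makes at most $O(nv/\epsilon)$ queries of $f$.
   Context: $f$ is submodular if $f(A\cup\{x\})-f(A)\ge f(B\cup\{x\})-f(B)$ for all $A\subseteq B\subseteq U$, $x\notin B$; write $\Delta f(S,x)=f(S\cup\{x\})-f(S)$. Algorithm nonmono-bi (the quantities $2/\epsilon$, $p_jv$ and $2p_jv/\epsilon$ are treated as integers): start with $S=\emptyset$. For $i=1,\dots,2/\epsilon$: for $j=1,\dots,N$: repeat $p_j v$ times: let $M\subseteq U_j\setminus S$ be a set of size $2p_jv/\epsilon$ maximizing $\sum_{x\in M}\Delta f(S,x)$; sample $u$ uniformly at random from $M$; set $S\gets S\cup\{u\}$. Output $S$.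
   Formalization: Each U_j is padded with twice 2p_jv/ε dummy elements of zero marginal value, which M may contain and which are dropped from the output S; without them M may not exist or may be forced to contain elements of negative marginal, and the (1/e-ε) bound fails for some f. *)

theory Defs
  imports "HOL-Probability.Probability"
begin

definition submodular_on :: "'a set \<Rightarrow> ('a set \<Rightarrow> real) \<Rightarrow> bool" where
  "submodular_on U f \<longleftrightarrow>
     (\<forall>A B x. A \<subseteq> B \<and> B \<subseteq> U \<and> x \<in> U - B \<longrightarrow>
        f (insert x A) - f A \<ge> f (insert x B) - f B)"

text \<open>
  Randomized computations with oracle access to a set function. A computation maps the oracle to
  the joint distribution of its result and of the number of oracle queries it made. Algorithms are
  composed from the four operations below only, so that the oracle is visible to them solely
  through \<open>oc_query\<close>.
\<close>

type_synonym ('a, 'r) oracle_comp = "('a set \<Rightarrow> real) \<Rightarrow> ('r \<times> nat) pmf"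

definition oc_return :: "'r \<Rightarrow> ('a, 'r) oracle_comp" where
  "oc_return r = (\<lambda>f. return_pmf (r, 0))"

definition oc_bind ::
  "('a, 'r) oracle_comp \<Rightarrow> ('r \<Rightarrow> ('a, 's) oracle_comp) \<Rightarrow> ('a, 's) oracle_comp" where
  "oc_bind c k = (\<lambda>f. bind_pmf (c f) (\<lambda>(r, a). map_pmf (\<lambda>(s, b). (s, a + b)) (k r f)))"

text \<open>
  Querying a family \<open>Q\<close> costs one query per member; the answer carries no information outside \<open>Q\<close>.
  To be used with finite \<open>Q\<close> only.
\<close>

definition oc_query :: "'a set set \<Rightarrow> ('a, 'a set \<Rightarrow> real) oracle_comp" where
  "oc_query Q = (\<lambda>f. return_pmf (restrict f Q, card Q))"

definition oc_sample :: "'r set \<Rightarrow> ('a, 'r) oracle_comp" where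
  "oc_sample M = (\<lambda>f. map_pmf (\<lambda>r. (r, 0)) (pmf_of_set M))"

primrec oc_for :: "'i list \<Rightarrow> ('i \<Rightarrow> 's \<Rightarrow> ('a, 's) oracle_comp) \<Rightarrow> 's \<Rightarrow> ('a, 's) oracle_comp" where
  "oc_for [] body s = oc_return s"
| "oc_for (i # is) body s = oc_bind (body i s) (oc_for is body)"

text \<open>
  A subroutine that returns a set of \<open>m\<close> elements of \<open>A\<close> of maximum total weight, with ties broken
  in some way.
\<close>

definition top_selector :: "('b set \<Rightarrow> nat \<Rightarrow> ('b \<Rightarrow> real) \<Rightarrow> 'b set) \<Rightarrow> bool" where
  "top_selector sel \<longleftrightarrow>
     (\<forall>A m w. finite A \<and> m \<le> card A \<longrightarrow>
        is_arg_max (\<lambda>M. sum w M) (\<lambda>M. M \<subseteq> A \<and> card M = m) (sel A m w))"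

text \<open>
  As usual for randomized greedy algorithms, every group is padded with dummy elements of zero
  marginal value, twice as many as a candidate set \<open>M\<close> has elements; they are dropped from the
  output. The element \<open>Inr (j, t)\<close> is the \<open>t\<close>-th dummy of group \<open>j\<close>. The padding ensures that a candidate set of
  the prescribed size always exists and that it is never forced to contain elements of negative
  marginal value; without it the approximation guarantee fails for nonmonotone functions. The value
  of a set with dummies is the value of its part in the original ground set, so the marginal value
  of a dummy is known without a query.
\<close>

type_synonym 'a padded = "'a + nat \<times> nat"

definition pad_group :: "nat \<Rightarrow> nat \<Rightarrow> 'a set \<Rightarrow> 'a padded set" where
  "pad_group m j V = Inl ` V \<union> (\<lambda>t. Inr (j, t)) ` {..<2 * m}"

definition real_part :: "'a padded set \<Rightarrow> 'a set" where
  "real_part S = Inl -` S"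

definition marginal :: "('a set \<Rightarrow> real) \<Rightarrow> 'a set \<Rightarrow> 'a padded \<Rightarrow> real" where
  "marginal g R = case_sum (\<lambda>x. g (insert x R) - g R) (\<lambda>_. 0)"

text \<open>One sampling step in group \<open>V\<close> (padded to \<open>W\<close>) with candidate sets of size \<open>m\<close>.\<close>

definition sampling_step ::
  "('a padded set \<Rightarrow> nat \<Rightarrow> ('a padded \<Rightarrow> real) \<Rightarrow> 'a padded set) \<Rightarrow>
   'a set \<Rightarrow> 'a padded set \<Rightarrow> nat \<Rightarrow> 'a padded set \<Rightarrow> ('a, 'a padded set) oracle_comp" where
  "sampling_step sel V W m S =
     (let R = real_part S in
      oc_bind (oc_query (\<Union>x\<in>V - R. {R, insert x R}))
        (\<lambda>g. oc_bind (oc_sample (sel (W - S) m (marginal g R)))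
          (\<lambda>u. oc_return (insert u S))))"

text \<open>
  Groups are indexed by \<open>{1..N}\<close>. The selector may depend on the three loop counters and on the
  current solution, so that ties may be broken differently at every step.
\<close>

definition nonmono_bi ::
  "(nat \<Rightarrow> nat \<Rightarrow> nat \<Rightarrow> 'a padded set \<Rightarrow>
      'a padded set \<Rightarrow> nat \<Rightarrow> ('a padded \<Rightarrow> real) \<Rightarrow> 'a padded set) \<Rightarrow>
   nat \<Rightarrow> (nat \<Rightarrow> 'a set) \<Rightarrow> (nat \<Rightarrow> real) \<Rightarrow> nat \<Rightarrow> real \<Rightarrow> ('a, 'a set) oracle_comp" where
  "nonmono_bi sel N V p v \<epsilon> =
     oc_bind
       (oc_for [1..<Suc (nat \<lfloor>2 / \<epsilon>\<rfloor>)] (\<lambda>i.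
          oc_for [1..<Suc N] (\<lambda>j.
            oc_for [1..<Suc (nat \<lfloor>p j * real v\<rfloor>)] (\<lambda>t S.
              let m = nat \<lfloor>2 * p j * real v / \<epsilon>\<rfloor>
              in sampling_step (sel i j t S) (V j) (pad_group m j (V j)) m S))) {})
       (\<lambda>S. oc_return (real_part S))"

end

theory Submission
  imports Defs
begin

text \<open>
  Let \<open>k = 2 / \<epsilon>\<close>, \<open>q\<^sub>j = p\<^sub>j v\<close> and \<open>m\<^sub>j = k q\<^sub>j\<close>. A sampling step in group \<open>j\<close> gains in
  expectation at least \<open>1 / m\<^sub>j\<close> times the sum of the positive parts of the marginals of the
  optimal elements of group \<open>j\<close> that are still missing. These sums decrease along the run, so that
  summing over a round gives
  \<open>E f(S\<^sub>i) - E f(S\<^sub>i\<^sub>-\<^sub>1) \<ge> (E f(OPT \<union> S\<^sub>i) - E f(S\<^sub>i)) / k\<close>. A fixed element survives a round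
  with probability at least \<open>(1 - 1 / m\<^sub>j) ^ q\<^sub>j \<ge> 1 - 1 / k\<close>, and a random set that contains every
  element with probability at most \<open>p\<close> satisfies \<open>E f(OPT \<union> S) \<ge> (1 - p) f(OPT)\<close>. Solving the
  resulting recurrence yields \<open>E f(S\<^sub>i) \<ge> i / (k + 1) (1 - 1 / k) ^ i f(OPT)\<close>, and for \<open>i = k\<close> the
  factor is at least \<open>(1 - 2 / (k + 1)) / e\<close>.
\<close>

section \<open>Oracle computations: invariants, query bounds and expectations\<close>

text \<open>Finite support is part of the predicate so that every real function of the outcome is
  integrable; the rules for expectations then take an \<open>oc_ensures\<close> fact instead of
  integrability conditions.\<close>

definition oc_ensures ::
  "('a set \<Rightarrow> real) \<Rightarrow> ('a, 'r) oracle_comp \<Rightarrow> 'r set \<Rightarrow> nat \<Rightarrow> bool" where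
  "oc_ensures f c Q b \<longleftrightarrow> finite (set_pmf (c f)) \<and> set_pmf (c f) \<subseteq> Q \<times> {..b}"

definition oc_expect ::
  "('a set \<Rightarrow> real) \<Rightarrow> ('a, 'r) oracle_comp \<Rightarrow> ('r \<Rightarrow> real) \<Rightarrow> real" where
  "oc_expect f c h = measure_pmf.expectation (c f) (\<lambda>(r, b). h r)"

lemma oc_bind_return_left: "oc_bind (oc_return r) k = k r"
  by (simp add: oc_bind_def oc_return_def fun_eq_iff bind_return_pmf split_def)

lemma oc_bind_return_right: "oc_bind c oc_return = c"
  by (simp add: oc_bind_def oc_return_def fun_eq_iff split_def bind_return_pmf')

lemma oc_bind_assoc: "oc_bind (oc_bind c k) l = oc_bind c (\<lambda>r. oc_bind (k r) l)"
  by (simp add: oc_bind_def fun_eq_iff split_def map_pmf_def bind_assoc_pmf bind_return_pmf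
      add.assoc)

text \<open>\<open>oc_for\<close> unfolds at the first iteration, while the inductions below run
  over the number of completed iterations and need the last one split off.\<close>

lemma oc_for_snoc: "oc_for (xs @ [x]) body s = oc_bind (oc_for xs body s) (body x)"
proof (induction xs arbitrary: s)
  case Nil
  have "oc_for [] body = oc_return"
    by (simp add: fun_eq_iff)
  then show ?case
    by (simp add: oc_bind_return_left oc_bind_return_right)
next
  case (Cons y xs)
  then have "oc_for (xs @ [x]) body = (\<lambda>s. oc_bind (oc_for xs body s) (body x))"
    by blast
  then show ?case
    by (simp add: oc_bind_assoc)
qed

lemma oc_ensures_return: "r \<in> Q \<Longrightarrow> oc_ensures f (oc_return r) Q 0"
  by (simp add: oc_ensures_def oc_return_def)

lemma oc_expect_return: "oc_expect f (oc_return r) h = h r"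
  by (simp add: oc_expect_def oc_return_def)

lemma oc_ensures_bind:
  assumes "oc_ensures f c P a" and "\<And>r. r \<in> P \<Longrightarrow> oc_ensures f (k r) Q b"
  shows "oc_ensures f (oc_bind c k) Q (a + b)"
proof -
  have k: "finite (set_pmf (k (fst z) f))" "set_pmf (k (fst z) f) \<subseteq> Q \<times> {..b}" "snd z \<le> a"
    if "z \<in> set_pmf (c f)" for z
  proof -
    have z: "fst z \<in> P" "snd z \<le> a"
      using that assms(1) by (auto simp: oc_ensures_def)
    with assms(2)[of "fst z"]
    show "finite (set_pmf (k (fst z) f))" "set_pmf (k (fst z) f) \<subseteq> Q \<times> {..b}" "snd z \<le> a"
      by (simp_all add: oc_ensures_def)
  qed
  have "fst y \<in> Q \<and> snd z + snd y \<le> a + b"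
    if "z \<in> set_pmf (c f)" "y \<in> set_pmf (k (fst z) f)" for y z
    using k(2,3)[OF that(1)] that(2) by (auto intro: add_mono)
  then show ?thesis
    using assms(1) k(1) by (auto simp: oc_ensures_def oc_bind_def split_def)
qed

text \<open>The law of total expectation; the \<open>oc_ensures\<close> facts supply the finite
  supports.\<close>

lemma oc_expect_bind:
  assumes "oc_ensures f c P a" and "\<And>r. r \<in> P \<Longrightarrow> oc_ensures f (k r) Q b"
  shows "oc_expect f (oc_bind c k) h = oc_expect f c (\<lambda>r. oc_expect f (k r) h)"
proof -
  have fin: "finite (set_pmf (c f))"
    using assms(1) by (simp add: oc_ensures_def)
  have fin': "finite (set_pmf (case z of (r, a) \<Rightarrow> map_pmf (\<lambda>(s, b). (s, a + b)) (k r f)))"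
    if "z \<in> set_pmf (c f)" for z
  proof -
    have "fst z \<in> P"
      using that assms(1) by (auto simp: oc_ensures_def)
    then show ?thesis
      using assms(2)[of "fst z"] by (simp add: oc_ensures_def split_def)
  qed
  show ?thesis
    unfolding oc_expect_def oc_bind_def
    by (subst pmf_expectation_bind[OF fin fin'], simp, simp,
        subst integral_measure_pmf[OF fin])
      (auto simp: split_def)
qed

lemma oc_expect_mono:
  assumes "oc_ensures f c P a" and "\<And>r. r \<in> P \<Longrightarrow> g r \<le> h r"
  shows "oc_expect f c g \<le> oc_expect f c h"
  unfolding oc_expect_def
  using assms
  by (intro integral_mono_AE integrable_measure_pmf_finite)
    (auto simp: oc_ensures_def AE_measure_pmf_iff)

lemma oc_expect_cmult: "oc_expect f c (\<lambda>r. a * h r) = a * oc_expect f c h"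
  by (simp add: oc_expect_def split_def)

lemma oc_expect_diff:
  assumes "oc_ensures f c P b"
  shows "oc_expect f c (\<lambda>r. g r - h r) = oc_expect f c g - oc_expect f c h"
  using assms unfolding oc_expect_def split_def
  by (intro Bochner_Integration.integral_diff integrable_measure_pmf_finite)
    (auto simp: oc_ensures_def)

lemma upt_1_Suc_Suc: "[1..<Suc (Suc n)] = [1..<Suc n] @ [Suc n]"
  by simp

lemma oc_ensures_for:
  assumes "\<And>i s. i < n \<Longrightarrow> s \<in> P i \<Longrightarrow> oc_ensures f (body (Suc i) s) (P (Suc i)) (b (Suc i))"
    and "s \<in> P 0"
  shows "oc_ensures f (oc_for [1..<Suc n] body s) (P n) (\<Sum>i=1..n. b i)"
  using assms(1)
proof (induction n)
  case 0
  then show ?case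
    using assms(2) by (simp add: oc_ensures_return)
next
  case (Suc n)
  show ?case
    unfolding upt_1_Suc_Suc oc_for_snoc
    using oc_ensures_bind[OF Suc.IH Suc.prems[of n]] Suc.prems by (simp add: add.commute)
qed

text \<open>\<open>h i\<close> is a potential after \<open>i\<close> completed iterations that does
  not drop in expectation from any state in the invariant \<open>P i\<close>. The lower bounds for
  groups and rounds are instances with a suitable \<open>h\<close>.\<close>

lemma oc_expect_for_ge:
  assumes "\<And>i s. i < n \<Longrightarrow> s \<in> P i \<Longrightarrow> oc_ensures f (body (Suc i) s) (P (Suc i)) (b (Suc i))"
    and "\<And>i s. i < n \<Longrightarrow> s \<in> P i \<Longrightarrow> h i s \<le> oc_expect f (body (Suc i) s) (h (Suc i))"
    and "s \<in> P 0"
  shows "h 0 s \<le> oc_expect f (oc_for [1..<Suc n] body s) (h n)"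
  using assms(1,2)
proof (induction n)
  case 0
  then show ?case
    by (simp add: oc_expect_return)
next
  case (Suc n)
  have ens: "oc_ensures f (oc_for [1..<Suc n] body s) (P n) (\<Sum>i=1..n. b i)"
    using Suc.prems(1) assms(3) by (intro oc_ensures_for) auto
  have "h 0 s \<le> oc_expect f (oc_for [1..<Suc n] body s) (h n)"
    using Suc.prems by (intro Suc.IH) auto
  also have "\<dots> \<le> oc_expect f (oc_for [1..<Suc n] body s)
      (\<lambda>r. oc_expect f (body (Suc n) r) (h (Suc n)))"
    using Suc.prems(2) by (intro oc_expect_mono[OF ens]) auto
  also have "\<dots> = oc_expect f (oc_for [1..<Suc (Suc n)] body s) (h (Suc n))"
    unfolding upt_1_Suc_Suc oc_for_snoc
    using Suc.prems(1)[of n] by (intro oc_expect_bind[OF ens, symmetric]) auto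
  finally show ?case .
qed

section \<open>Submodular functions and random subsets\<close>

lemma submodular_on_marginal_antimono:
  assumes "submodular_on U f" "A \<subseteq> B" "B \<subseteq> U" "x \<in> U - B"
  shows "f (insert x B) - f B \<le> f (insert x A) - f A"
  using assms unfolding submodular_on_def by blast

text \<open>Add the elements of \<open>T\<close> one after another: by submodularity each marginal
  is at most the one with respect to \<open>R\<close>.\<close>

lemma submodular_on_union_le_sum_marginals:
  assumes f: "submodular_on U f" and "R \<subseteq> U" "finite T" "T \<subseteq> U"
  shows "f (T \<union> R) - f R \<le> (\<Sum>x\<in>T. f (insert x R) - f R)"
  using assms(3,4)
proof (induction T rule: finite_induct)
  case (insert x T)
  have "f (insert x (T \<union> R)) - f (T \<union> R) \<le> f (insert x R) - f R"
  proof (cases "x \<in> R")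
    case False
    with insert show ?thesis
      using assms(2) by (intro submodular_on_marginal_antimono[OF f]) auto
  qed (simp add: insert_absorb)
  with insert show ?case
    by simp
qed simp

text \<open>Prepares the random subset bound for \<open>\<lambda>A. f (OPT \<union> A)\<close>,
  whose value at the empty set is \<open>f OPT\<close>.\<close>

lemma submodular_on_union_left:
  assumes f: "submodular_on U f" and "T \<subseteq> U"
  shows "submodular_on U (\<lambda>A. f (T \<union> A))"
  unfolding submodular_on_def
proof (intro allI impI)
  fix A B x
  assume AB: "A \<subseteq> B \<and> B \<subseteq> U \<and> x \<in> U - B"
  show "f (T \<union> insert x B) - f (T \<union> B) \<le> f (T \<union> insert x A) - f (T \<union> A)"
  proof (cases "x \<in> T")
    case True
    then show ?thesis
      by (simp add: insert_absorb)
  next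
    case False
    with AB show ?thesis
      using submodular_on_marginal_antimono[OF f, of "T \<union> A" "T \<union> B" x] assms(2) by auto
  qed
qed

text \<open>
  The coefficients are the marginals along the chain that adds the elements by decreasing weight
  (a vertex of the base polytope); summation by parts then only uses nonnegativity.
\<close>

lemma submodular_on_linear_minorant:
  fixes w :: "'a \<Rightarrow> real"
  assumes "finite U" and "submodular_on U g" and "\<And>A. A \<subseteq> U \<Longrightarrow> 0 \<le> g A"
    and "\<And>x. x \<in> U \<Longrightarrow> l \<le> w x \<and> w x \<le> p" and "l \<le> p"
  obtains c where "\<And>A. A \<subseteq> U \<Longrightarrow> g {} + (\<Sum>x\<in>A. c x) \<le> g A"
    and "l * g U - p * g {} \<le> (\<Sum>x\<in>U. w x * c x)"
proof -
  have "\<exists>c. (\<forall>A\<subseteq>U. g {} + (\<Sum>x\<in>A. c x) \<le> g A) \<and> l * g U - p * g {} \<le> (\<Sum>x\<in>U. w x * c x)"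
    using assms
  \<comment> \<open>Ranking by \<open>- w x\<close> makes the inserted element one of least
    weight.\<close>
  proof (induction U arbitrary: l rule: finite_ranking_induct[where f = "\<lambda>x. - w x"])
    case empty
    then have "l * g {} \<le> p * g {}"
      by (intro mult_right_mono) auto
    then show ?case
      by auto
  next
    case (insert x S)
    show ?case
    proof (cases "x \<in> S")
      case True
      then show ?thesis
        using insert.IH insert.prems by (simp add: insert_absorb)
    next
      case False
      have "submodular_on S g"
        using insert.prems(1) unfolding submodular_on_def by blast
      \<comment> \<open>The hypothesis is used with \<open>w x\<close> in place of \<open>l\<close>,
        as every element of \<open>S\<close> has weight at least \<open>w x\<close>.\<close>
      then obtain c where c: "\<And>A. A \<subseteq> S \<Longrightarrow> g {} + (\<Sum>x\<in>A. c x) \<le> g A"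
        and wc: "w x * g S - p * g {} \<le> (\<Sum>x\<in>S. w x * c x)"
        using insert.IH[of "w x"] insert.prems insert.hyps
        by (metis insertI1 insertI2 neg_le_iff_le order_refl subset_insertI2)
      define d where "d = c(x := g (insert x S) - g S)"
      have "g {} + (\<Sum>y\<in>A. d y) \<le> g A" if A: "A \<subseteq> insert x S" for A
      proof (cases "x \<in> A")
        case True
        let ?B = "A - {x}"
        have B: "?B \<subseteq> S" "finite ?B" and A_eq: "A = insert x ?B"
          using A True insert.hyps(1) finite_subset by auto
        have "(\<Sum>y\<in>?B. d y) = (\<Sum>y\<in>?B. c y)"
          by (intro sum.cong) (auto simp: d_def)
        moreover have "(\<Sum>y\<in>insert x ?B. d y) = d x + (\<Sum>y\<in>?B. d y)"
          using B(2) by (intro sum.insert) auto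
        ultimately have "g {} + (\<Sum>y\<in>insert x ?B. d y) \<le> g ?B + (g (insert x S) - g S)"
          using c[OF B(1)] by (simp add: d_def)
        also have "\<dots> \<le> g (insert x ?B)"
          using submodular_on_marginal_antimono[OF insert.prems(1) B(1) subset_insertI, of x] False
          by auto
        finally show ?thesis
          using A_eq by simp
      next
        case False
        then have "A \<subseteq> S" "(\<Sum>y\<in>A. d y) = (\<Sum>y\<in>A. c y)"
          using A by (auto intro!: sum.cong simp: d_def)
        then show ?thesis
          using c by simp
      qed
      \<comment> \<open>The new term \<open>w x * (g (insert x S) - g S)\<close> cancels the
        \<open>w x * g S\<close> of the hypothesis; then \<open>w x\<close> is lowered to
        \<open>l\<close>, where \<open>g (insert x S) \<ge> 0\<close> enters.\<close>
      moreover have "l * g (insert x S) - p * g {} \<le> (\<Sum>y\<in>insert x S. w y * d y)"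
      proof -
        have "(\<Sum>y\<in>S. w y * d y) = (\<Sum>y\<in>S. w y * c y)"
          using False by (intro sum.cong) (auto simp: d_def)
        moreover have "l * g (insert x S) \<le> w x * g (insert x S)"
          using insert.prems by (intro mult_right_mono) auto
        ultimately show ?thesis
          using wc insert.hyps(1) False by (simp add: d_def algebra_simps)
      qed
      ultimately show ?thesis
        by blast
    qed
  qed
  then show ?thesis
    using that by blast
qed

text \<open>Memberships may be correlated arbitrarily: averaging a linear minorant of
  \<open>g\<close> involves only the probabilities of the single events
  \<open>x \<in> A\<close>.\<close>

lemma submodular_on_expectation_random_subset_ge:
  fixes \<mu> :: "'a set pmf"
  assumes "finite U" and "submodular_on U g" and nonneg: "\<And>A. A \<subseteq> U \<Longrightarrow> 0 \<le> g A"
    and \<mu>: "set_pmf \<mu> \<subseteq> Pow U"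
    and p: "\<And>x. x \<in> U \<Longrightarrow> measure_pmf.prob \<mu> {A. x \<in> A} \<le> p" "0 \<le> p"
  shows "(1 - p) * g {} \<le> measure_pmf.expectation \<mu> g"
proof -
  let ?w = "\<lambda>x. measure_pmf.prob \<mu> {A. x \<in> A}"
  \<comment> \<open>The probabilities are bounded below by \<open>l = 0\<close>, which removes the
    term in \<open>g U\<close>.\<close>
  obtain c where c: "\<And>A. A \<subseteq> U \<Longrightarrow> g {} + (\<Sum>x\<in>A. c x) \<le> g A"
    and wc: "0 * g U - p * g {} \<le> (\<Sum>x\<in>U. ?w x * c x)"
    using submodular_on_linear_minorant[OF assms(1-3), of 0 ?w p] p by auto
  have fin: "finite (set_pmf \<mu>)"
    using \<mu> assms(1) finite_subset by blast
  note int = integrable_measure_pmf_finite[OF fin]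
  have "(1 - p) * g {} \<le> g {} + (\<Sum>x\<in>U. ?w x * c x)"
    using wc by (simp add: algebra_simps)
  also have "\<dots> = measure_pmf.expectation \<mu> (\<lambda>A. g {} + (\<Sum>x\<in>U. indicator {A. x \<in> A} A * c x))"
    by (simp add: int)
  also have "\<dots> \<le> measure_pmf.expectation \<mu> g"
  proof (intro integral_mono_AE int, unfold AE_measure_pmf_iff, intro ballI)
    fix A
    assume "A \<in> set_pmf \<mu>"
    with \<mu> have A: "A \<subseteq> U"
      by auto
    have "(\<Sum>x\<in>U. indicator {A. x \<in> A} A * c x) = (\<Sum>x\<in>A. c x)"
      using A assms(1) by (intro sum.mono_neutral_cong_right) (auto simp: indicator_def)
    with c[OF A] show "g {} + (\<Sum>x\<in>U. indicator {A. x \<in> A} A * c x) \<le> g A"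
      by simp
  qed
  finally show ?thesis .
qed

section \<open>A numerical estimate\<close>

text \<open>For \<open>k > 1\<close> the inverse of \<open>1 - 1 / k\<close> is
  \<open>1 + 1 / (k - 1) \<le> exp (1 / (k - 1))\<close>, so \<open>(1 - 1 / k) ^ (k - 1)\<close> is
  at least \<open>1 / exp 1\<close>; one more factor remains. For \<open>k = 1\<close> both sides
  vanish.\<close>

lemma one_minus_inverse_power_ge:
  assumes "0 < k"
  shows "(1 - 1 / real k) / exp 1 \<le> (1 - 1 / real k) ^ k"
proof (cases "k = 1")
  case False
  with assms have k: "1 < k"
    by simp
  let ?r = "1 - 1 / real k"
  have r: "0 < ?r"
    using k by simp
  have "inverse ?r = 1 + 1 / (real k - 1)"
    using k by (simp add: field_simps)
  also have "\<dots> \<le> exp (1 / (real k - 1))"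
    by (rule exp_ge_add_one_self)
  finally have "inverse ?r ^ (k - 1) \<le> exp (1 / (real k - 1)) ^ (k - 1)"
    using r by (intro power_mono) auto
  also have "\<dots> = exp 1"
    using k by (simp add: of_nat_diff flip: exp_of_nat_mult)
  finally have "1 / exp 1 \<le> ?r ^ (k - 1)"
    using r by (simp add: power_inverse field_simps)
  then have "?r * (1 / exp 1) \<le> ?r * ?r ^ (k - 1)"
    using r by (intro mult_left_mono) auto
  then show ?thesis
    using assms by (simp flip: power_Suc)
qed simp

section \<open>The padded instance with integral parameters\<close>

text \<open>The natural numbers \<open>k\<close>, \<open>q j\<close> and \<open>m j\<close> stand
  for \<open>2 / \<epsilon>\<close>, \<open>p j * v\<close> and the size of a candidate set, so that
  no rounding occurs in the analysis.\<close>

locale padded_instance =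
  fixes f :: "'a set \<Rightarrow> real" and U :: "'a set" and N :: nat and V :: "nat \<Rightarrow> 'a set"
    and q m :: "nat \<Rightarrow> nat" and k :: nat and OPT :: "'a set"
    and sel :: "nat \<Rightarrow> nat \<Rightarrow> nat \<Rightarrow> 'a padded set \<Rightarrow>
      'a padded set \<Rightarrow> nat \<Rightarrow> ('a padded \<Rightarrow> real) \<Rightarrow> 'a padded set"
  assumes finite_U: "finite U" and submod: "submodular_on U f"
    and nonneg: "\<And>A. A \<subseteq> U \<Longrightarrow> 0 \<le> f A"
    and U_eq: "(\<Union>j\<in>{1..N}. V j) = U" and disj: "disjoint_family_on V {1..N}"
    and k_pos: "0 < k" and m_eq: "\<And>j. j \<in> {1..N} \<Longrightarrow> m j = k * q j"
    and sel: "\<And>i j t S. top_selector (sel i j t S)"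
    and OPT_subset: "OPT \<subseteq> U" and OPT_card: "\<And>j. j \<in> {1..N} \<Longrightarrow> card (OPT \<inter> V j) \<le> q j"
begin

abbreviation W :: "nat \<Rightarrow> 'a padded set" where
  "W j \<equiv> pad_group (m j) j (V j)"

text \<open>The bounds \<open>c j\<close> count dummies as well: a step in group \<open>j\<close>
  consumes one unit whatever it draws, and the bound on used dummies shows that enough are
  free.\<close>

definition states :: "(nat \<Rightarrow> nat) \<Rightarrow> 'a padded set set" where
  "states c = {S. S \<subseteq> (\<Union>j\<in>{1..N}. W j) \<and> (\<forall>j\<in>{1..N}. card (S \<inter> W j) \<le> c j)}"

definition step :: "nat \<Rightarrow> nat \<Rightarrow> nat \<Rightarrow> 'a padded set \<Rightarrow> ('a, 'a padded set) oracle_comp" where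
  "step i j t S = sampling_step (sel i j t S) (V j) (W j) (m j) S"

definition group_loop :: "nat \<Rightarrow> nat \<Rightarrow> 'a padded set \<Rightarrow> ('a, 'a padded set) oracle_comp" where
  "group_loop i j = oc_for [1..<Suc (q j)] (step i j)"

definition round_loop :: "nat \<Rightarrow> 'a padded set \<Rightarrow> ('a, 'a padded set) oracle_comp" where
  "round_loop i = oc_for [1..<Suc N] (group_loop i)"

definition run :: "nat \<Rightarrow> ('a, 'a padded set) oracle_comp" where
  "run n = oc_for [1..<Suc n] round_loop {}"

text \<open>Positive parts, because a candidate set may hold dummies in place of optimal elements of
  negative marginal. They also make the sum antitone in \<open>R\<close>: marginals shrink, and the
  terms that disappear are nonnegative.\<close>

definition gain :: "nat \<Rightarrow> 'a set \<Rightarrow> real" where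
  "gain j R = (\<Sum>x\<in>OPT \<inter> V j - R. max 0 (f (insert x R) - f R))"

lemma states_cong:
  assumes "\<And>j. j \<in> {1..N} \<Longrightarrow> c j = d j"
  shows "states c = states d"
  using assms by (auto simp: states_def)

lemma V_subset: "j \<in> {1..N} \<Longrightarrow> V j \<subseteq> U"
  using U_eq by auto

lemma finite_V: "j \<in> {1..N} \<Longrightarrow> finite (V j)"
  using V_subset finite_U finite_subset by blast

lemma finite_W: "j \<in> {1..N} \<Longrightarrow> finite (W j)"
  by (simp add: pad_group_def finite_V)

lemma Inl_in_W [simp]: "Inl x \<in> W j \<longleftrightarrow> x \<in> V j"
  by (auto simp: pad_group_def)

lemma W_disjoint:
  assumes "j \<in> {1..N}" "j' \<in> {1..N}" "j \<noteq> j'" "u \<in> W j"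
  shows "u \<notin> W j'"
proof -
  have "V j \<inter> V j' = {}"
    using disj assms(1-3) by (auto simp: disjoint_family_on_def)
  then show ?thesis
    using assms(3,4) by (auto simp: pad_group_def)
qed

lemma real_part_states: "S \<in> states c \<Longrightarrow> real_part S \<subseteq> U"
  using U_eq by (auto simp: states_def real_part_def pad_group_def)

lemma real_part_insert_Inl [simp]: "real_part (insert (Inl x) S) = insert x (real_part S)"
  and real_part_insert_Inr [simp]: "real_part (insert (Inr y) S) = real_part S"
  and in_real_part [simp]: "x \<in> real_part S \<longleftrightarrow> Inl x \<in> S"
  by (auto simp: real_part_def)

lemma gain_antimono:
  assumes "R \<subseteq> R'" "R' \<subseteq> U"
  shows "gain j R' \<le> gain j R"
proof -
  have fin: "finite (OPT \<inter> V j - R)"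
    using OPT_subset finite_U finite_subset by blast
  have "gain j R' \<le> (\<Sum>x\<in>OPT \<inter> V j - R'. max 0 (f (insert x R) - f R))"
    unfolding gain_def
  proof (intro sum_mono max.mono order_refl)
    fix x
    assume "x \<in> OPT \<inter> V j - R'"
    then show "f (insert x R') - f R' \<le> f (insert x R) - f R"
      using OPT_subset assms by (intro submodular_on_marginal_antimono[OF submod]) auto
  qed
  also have "\<dots> \<le> gain j R"
    unfolding gain_def using assms(1) by (intro sum_mono2 fin) auto
  finally show ?thesis .
qed

lemma union_OPT_le_sum_gain:
  assumes "R \<subseteq> U"
  shows "f (OPT \<union> R) - f R \<le> (\<Sum>j=1..N. gain j R)"
proof -
  have fin: "finite (OPT - R)"
    using OPT_subset finite_U finite_subset by blast
  have "OPT \<union> R = (OPT - R) \<union> R"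
    by auto
  then have "f (OPT \<union> R) - f R \<le> (\<Sum>x\<in>OPT - R. f (insert x R) - f R)"
    using submodular_on_union_le_sum_marginals[OF submod assms fin] OPT_subset by auto
  also have "\<dots> \<le> (\<Sum>x\<in>OPT - R. max 0 (f (insert x R) - f R))"
    by (intro sum_mono) auto
  also have "OPT - R = (\<Union>j\<in>{1..N}. OPT \<inter> V j - R)"
    using OPT_subset U_eq by auto
  also have "(\<Sum>x\<in>\<dots>. max 0 (f (insert x R) - f R)) = (\<Sum>j=1..N. gain j R)"
    unfolding gain_def using disj fin
    by (intro sum.UNION_disjoint)
      (auto simp: disjoint_family_on_def finite_V)
  finally show ?thesis .
qed

section \<open>One sampling step\<close>

text \<open>The interface to a step for the later lemmas: expectations are averages over
  \<open>M\<close>, and \<open>M\<close> is optimal for the marginals of \<open>f\<close> itself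
  rather than of the restricted oracle answer.\<close>

lemma step_obtains_candidates:
  assumes S: "S \<in> states c" and j: "j \<in> {1..N}" and c: "c j < m j"
  obtains M where "M \<subseteq> W j - S" "card M = m j" "finite M"
    and "\<And>M'. M' \<subseteq> W j - S \<Longrightarrow> card M' = m j \<Longrightarrow>
      sum (marginal f (real_part S)) M' \<le> sum (marginal f (real_part S)) M"
    and "\<And>h. oc_expect f (step i j t S) h = (\<Sum>u\<in>M. h (insert u S)) / m j"
    and "oc_ensures f (step i j t S) ((\<lambda>u. insert u S) ` M) (2 * card U)"
proof -
  define R where "R = real_part S"
  define Q where "Q = (\<Union>x\<in>V j - R. {R, insert x R})"
  define M where "M = sel i j t S (W j - S) (m j) (marginal (restrict f Q) R)"
  have dummies: "card ((\<lambda>t. Inr (j, t) :: 'a padded) ` {..<2 * m j}) = 2 * m j"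
    by (subst card_image) (auto simp: inj_on_def)
  have "card ((\<lambda>t. Inr (j, t) :: 'a padded) ` {..<2 * m j}) \<le> card (W j)"
    using finite_W[OF j] by (intro card_mono) (auto simp: pad_group_def)
  then have "2 * m j \<le> card (W j)"
    by (simp only: dummies)
  moreover have "card (S \<inter> W j) \<le> c j"
    using S j by (auto simp: states_def)
  moreover have "card (W j - S) = card (W j) - card (S \<inter> W j)"
    using finite_W[OF j] by (simp add: card_Diff_subset_Int Int_commute)
  \<comment> \<open>\<open>W j\<close> has at least \<open>2 * m j\<close> elements, of which fewer
    than \<open>m j\<close> are used.\<close>
  ultimately have "m j \<le> card (W j - S)"
    using c by linarith
  then have arg: "is_arg_max (sum (marginal (restrict f Q) R)) (\<lambda>M. M \<subseteq> W j - S \<and> card M = m j) M"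
    using sel[of i j t S] finite_W[OF j] unfolding top_selector_def M_def by blast
  then have M: "M \<subseteq> W j - S" "card M = m j"
    by (auto simp: is_arg_max_def)
  have fin: "finite M"
    using M(1) finite_W[OF j] finite_subset by blast
  have ne: "M \<noteq> {}"
    using M(2) c by auto
  \<comment> \<open>Real candidates lie outside \<open>R\<close>, so both sets in their marginal
    belong to \<open>Q\<close>; a dummy has marginal 0 for every oracle.\<close>
  have marg: "sum (marginal (restrict f Q) R) M' = sum (marginal f R) M'" if "M' \<subseteq> W j - S" for M'
  proof (intro sum.cong refl)
    fix u
    assume "u \<in> M'"
    with that have u: "u \<in> W j" "u \<notin> S"
      by auto
    show "marginal (restrict f Q) R u = marginal f R u"
    proof (cases u)
      case (Inl x)
      with u have "x \<in> V j - R"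
        by (simp add: R_def)
      then have "R \<in> Q" "insert x R \<in> Q"
        by (auto simp: Q_def)
      with Inl show ?thesis
        by (simp add: marginal_def)
    qed (simp add: marginal_def)
  qed
  have "card Q \<le> (\<Sum>x\<in>V j - R. card {R, insert x R})"
    unfolding Q_def using finite_V[OF j] by (intro card_UN_le) auto
  also have "\<dots> \<le> (\<Sum>x\<in>V j - R. 2)"
    by (intro sum_mono) (auto simp: card_insert_if)
  also have "\<dots> \<le> 2 * card U"
    using card_mono[OF finite_U, of "V j - R"] V_subset[OF j] by auto
  finally have Q: "card Q \<le> 2 * card U" .
  have step: "step i j t S f = map_pmf (\<lambda>u. (insert u S, card Q)) (pmf_of_set M)"
    unfolding step_def sampling_step_def Let_def oc_bind_def oc_query_def oc_sample_def oc_return_def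
      R_def[symmetric] Q_def[symmetric]
    by (simp add: bind_return_pmf map_pmf_def bind_assoc_pmf M_def)
  show ?thesis
  proof
    show "sum (marginal f (real_part S)) M' \<le> sum (marginal f (real_part S)) M"
      if "M' \<subseteq> W j - S" "card M' = m j" for M'
      using arg that marg[OF that(1)] marg[OF M(1)] by (auto simp: is_arg_max_def R_def not_less)
    show "oc_expect f (step i j t S) h = (\<Sum>u\<in>M. h (insert u S)) / m j" for h
      by (simp add: oc_expect_def step integral_pmf_of_set[OF ne fin] M(2))
    show "oc_ensures f (step i j t S) ((\<lambda>u. insert u S) ` M) (2 * card U)"
      using Q by (auto simp: oc_ensures_def step set_pmf_of_set[OF ne fin] fin)
  qed (use M fin in auto)
qed

lemma insert_in_states:
  assumes S: "S \<in> states c" and j: "j \<in> {1..N}" and u: "u \<in> W j"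
  shows "insert u S \<in> states (c(j := Suc (c j)))"
proof -
  have "card (insert u S \<inter> W j') \<le> (c(j := Suc (c j))) j'" if j': "j' \<in> {1..N}" for j'
  proof (cases "j' = j")
    case True
    then have "card (insert u S \<inter> W j') \<le> Suc (card (S \<inter> W j))"
      using u by (simp add: card_insert_le_m1 card_insert_if)
    with True S j show ?thesis
      by (force simp: states_def)
  next
    case False
    then have "insert u S \<inter> W j' = S \<inter> W j'"
      using W_disjoint[OF j j' _ u] by auto
    with False S j' show ?thesis
      by (auto simp: states_def)
  qed
  then show ?thesis
    using S j u by (auto simp: states_def)
qed

lemma step_ensures:
  assumes "S \<in> states c" "j \<in> {1..N}" "c j < m j"
  shows "oc_ensures f (step i j t S) (states (c(j := Suc (c j)))) (2 * card U)"
  by (rule step_obtains_candidates[OF assms, of i t])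
    (use insert_in_states[OF assms(1,2)] in \<open>fastforce simp: oc_ensures_def\<close>)

text \<open>
  The maximizer is compared with the optimal elements of positive marginal value, filled up with
  unused dummies to the prescribed size.
\<close>

lemma step_gain:
  assumes S: "S \<in> states c" and j: "j \<in> {1..N}" and c: "c j < m j"
  shows "f (real_part S) + gain j (real_part S) / m j
    \<le> oc_expect f (step i j t S) (\<lambda>S'. f (real_part S'))"
proof -
  let ?R = "real_part S"
  obtain M where M: "M \<subseteq> W j - S" "card M = m j" "finite M"
    and max: "\<And>M'. M' \<subseteq> W j - S \<Longrightarrow> card M' = m j \<Longrightarrow>
      sum (marginal f ?R) M' \<le> sum (marginal f ?R) M"
    and E: "\<And>h. oc_expect f (step i j t S) h = (\<Sum>u\<in>M. h (insert u S)) / m j"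
    using step_obtains_candidates[OF assms] by metis
  define T where "T = {x \<in> OPT \<inter> V j - ?R. 0 < f (insert x ?R) - f ?R}"
  define D where "D = (\<lambda>t. Inr (j, t) :: 'a padded) ` {..<2 * m j}"
  have finT: "finite T"
    unfolding T_def using finite_V[OF j] by auto
  have "card T \<le> card (OPT \<inter> V j)"
    unfolding T_def using finite_V[OF j] by (intro card_mono) auto
  also have "\<dots> \<le> m j"
    using OPT_card[OF j] m_eq[OF j] k_pos by (metis le_trans mult_le_mono1 mult_1 Suc_leI One_nat_def)
  finally have cardT: "card T \<le> m j" .
  have D: "card D = 2 * m j" "finite D" "D \<subseteq> W j"
    unfolding D_def by (subst card_image) (auto simp: inj_on_def pad_group_def)
  \<comment> \<open>At most \<open>m j\<close> of the \<open>2 * m j\<close> dummies are used, so at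
    least \<open>m j\<close> are left to fill up \<open>T\<close>.\<close>
  have "card (D \<inter> S) \<le> card (S \<inter> W j)"
    using D finite_W[OF j] by (intro card_mono) auto
  also have "\<dots> \<le> m j"
    using S j c by (force simp: states_def)
  finally have "m j - card T \<le> card (D - S)"
    using D by (simp add: card_Diff_subset_Int)
  then obtain F where F: "F \<subseteq> D - S" "card F = m j - card T" "finite F"
    by (rule obtain_subset_with_card_n)
  have disjTF: "Inl ` T \<inter> F = {}"
    using F(1) by (auto simp: D_def)
  have "gain j ?R = (\<Sum>x\<in>T. f (insert x ?R) - f ?R)"
    unfolding gain_def T_def using finite_V[OF j] by (intro sum.mono_neutral_cong_right) auto
  also have "\<dots> = sum (marginal f ?R) (Inl ` T)"
    by (simp add: sum.reindex marginal_def)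
  also have "\<dots> = sum (marginal f ?R) (Inl ` T \<union> F)"
  proof -
    have "sum (marginal f ?R) F = 0"
      using F(1) by (intro sum.neutral) (auto simp: D_def marginal_def)
    then show ?thesis
      using disjTF finT F(3) by (simp add: sum.union_disjoint)
  qed
  also have "\<dots> \<le> sum (marginal f ?R) M"
  proof (rule max)
    show "Inl ` T \<union> F \<subseteq> W j - S"
      using F(1) D(3) by (auto simp: T_def)
    show "card (Inl ` T \<union> F) = m j"
      using disjTF finT F cardT by (simp add: card_Un_disjoint card_image)
  qed
  also have "\<dots> = (\<Sum>u\<in>M. f (real_part (insert u S)) - f ?R)"
    by (intro sum.cong) (auto simp: marginal_def split: sum.split)
  also have "\<dots> = (\<Sum>u\<in>M. f (real_part (insert u S))) - m j * f ?R"
    using M(2) by (simp add: sum_subtractf)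
  finally have "real (m j) * (f ?R + gain j ?R / m j) \<le> (\<Sum>u\<in>M. f (real_part (insert u S)))"
    using c by (simp add: distrib_left)
  then show ?thesis
    using c by (simp add: E pos_le_divide_eq mult.commute)
qed

text \<open>Every outcome enlarges the real part, so the inequality holds pointwise.
  \<open>A\<close> will be the accumulated gains that are subtracted in a potential.\<close>

lemma step_antimono:
  assumes S: "S \<in> states c" and j: "j \<in> {1..N}" and c: "c j < m j"
    and A: "\<And>R R'. R \<subseteq> R' \<Longrightarrow> R' \<subseteq> U \<Longrightarrow> A R' \<le> A R"
  shows "oc_expect f (step i j t S) (\<lambda>S'. A (real_part S')) \<le> A (real_part S)"
proof -
  obtain M where M: "M \<subseteq> W j - S" "card M = m j"
    and E: "\<And>h. oc_expect f (step i j t S) h = (\<Sum>u\<in>M. h (insert u S)) / m j"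
    using step_obtains_candidates[OF S j c] by metis
  have "(\<Sum>u\<in>M. A (real_part (insert u S))) \<le> (\<Sum>u\<in>M. A (real_part S))"
  proof (intro sum_mono A)
    fix u
    assume "u \<in> M"
    with M(1) have "insert u S \<in> states (c(j := Suc (c j)))"
      by (intro insert_in_states S j) auto
    then show "real_part (insert u S) \<subseteq> U"
      by (rule real_part_states)
  qed (auto simp: real_part_def)
  with M(2) c show ?thesis
    by (simp add: E field_simps)
qed

text \<open>At most one of the \<open>m j\<close> equally likely candidates is \<open>Inl x\<close>;
  if \<open>x\<close> is already present, both sides are 0.\<close>

lemma step_avoids:
  assumes S: "S \<in> states c" and j: "j \<in> {1..N}" and c: "c j < m j"
  shows "(1 - 1 / m j) * of_bool (Inl x \<notin> S) \<le> oc_expect f (step i j t S) (\<lambda>S'. of_bool (Inl x \<notin> S'))"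
proof (cases "Inl x \<in> S")
  case True
  obtain M where E: "\<And>h. oc_expect f (step i j t S) h = (\<Sum>u\<in>M. h (insert u S)) / m j"
    using step_obtains_candidates[OF S j c] by metis
  show ?thesis
    using True by (simp add: E)
next
  case False
  obtain M where M: "card M = m j" "finite M"
    and E: "\<And>h. oc_expect f (step i j t S) h = (\<Sum>u\<in>M. h (insert u S)) / m j"
    using step_obtains_candidates[OF S j c] by metis
  have "real (m j) - 1 \<le> card (M - {Inl x})"
    using M c by (simp add: card_Diff_singleton_if of_nat_diff)
  also have "\<dots> = (\<Sum>u\<in>M - {Inl x}. of_bool (Inl x \<notin> insert u S))"
    using False by (subst sum.cong[OF refl, where h = "\<lambda>_. 1"]) auto
  also have "\<dots> \<le> (\<Sum>u\<in>M. of_bool (Inl x \<notin> insert u S))"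
    using M(2) by (intro sum_mono2) auto
  finally have "(real (m j) - 1) / m j \<le> (\<Sum>u\<in>M. of_bool (Inl x \<notin> insert u S)) / m j"
    by (rule divide_right_mono) simp
  then show ?thesis
    using False c by (simp add: E diff_divide_distrib)
qed

lemma step_avoids_other_group:
  assumes S: "S \<in> states c" and j: "j \<in> {1..N}" and c: "c j < m j"
    and x: "x \<in> V j'" and j': "j' \<in> {1..N}" "j' \<noteq> j"
  shows "of_bool (Inl x \<notin> S) \<le> oc_expect f (step i j t S) (\<lambda>S'. of_bool (Inl x \<notin> S'))"
proof -
  obtain M where M: "M \<subseteq> W j - S" "card M = m j"
    and E: "\<And>h. oc_expect f (step i j t S) h = (\<Sum>u\<in>M. h (insert u S)) / m j"
    using step_obtains_candidates[OF S j c] by metis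
  have "Inl x \<notin> W j"
    using W_disjoint[OF j'(1) j j'(2), of "Inl x"] x by simp
  then have "Inl x \<noteq> u" if "u \<in> M" for u
    using M(1) that by blast
  then have "(\<Sum>u\<in>M. of_bool (Inl x \<notin> insert u S)) = (\<Sum>u\<in>M. of_bool (Inl x \<notin> S) :: real)"
    by (intro sum.cong) auto
  then show ?thesis
    using M(2) c by (simp add: E)
qed

section \<open>The steps in one group\<close>

text \<open>\<open>t\<close> counts the completed steps of the group, so the bound before the next
  one is \<open>c j + t < m j\<close>, as a step requires.\<close>

lemma step_in_group:
  assumes "j \<in> {1..N}" "c j + q j \<le> m j" "t < q j" "S \<in> states (c(j := c j + t))"
  shows "oc_ensures f (step i j t' S) (states (c(j := c j + Suc t))) (2 * card U)"
  using step_ensures[OF assms(4,1)] assms(2,3) by simp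

lemma group_ensures:
  assumes "S \<in> states c" "j \<in> {1..N}" "c j + q j \<le> m j"
  shows "oc_ensures f (group_loop i j S) (states (c(j := c j + q j))) (q j * (2 * card U))"
proof -
  have "oc_ensures f (group_loop i j S) (states (c(j := c j + q j))) (\<Sum>t=1..q j. 2 * card U)"
    unfolding group_loop_def
    by (rule oc_ensures_for[where P = "\<lambda>t. states (c(j := c j + t))"])
      (use step_in_group assms in auto)
  then show ?thesis
    by simp
qed

lemma group_expect_ge:
  assumes "S \<in> states c" "j \<in> {1..N}" "c j + q j \<le> m j"
    and "\<And>t S. t < q j \<Longrightarrow> S \<in> states (c(j := c j + t)) \<Longrightarrow>
      h t S \<le> oc_expect f (step i j (Suc t) S) (h (Suc t))"
  shows "h 0 S \<le> oc_expect f (group_loop i j S) (h (q j))"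
  unfolding group_loop_def
  by (rule oc_expect_for_ge[where P = "\<lambda>t. states (c(j := c j + t))" and b = "\<lambda>_. 2 * card U"])
    (use step_in_group assms in auto)

text \<open>\<open>A\<close> carries the gains of the groups already handled in the round. As gains
  only shrink, all of them can be evaluated at the end of the group.\<close>

lemma group_gain:
  assumes S: "S \<in> states c" and j: "j \<in> {1..N}" and c: "c j + q j \<le> m j"
    and A: "\<And>R R'. R \<subseteq> R' \<Longrightarrow> R' \<subseteq> U \<Longrightarrow> A R' \<le> A R"
  shows "f (real_part S) - A (real_part S)
    \<le> oc_expect f (group_loop i j S) (\<lambda>S'. f (real_part S') - (A (real_part S') + gain j (real_part S') / k))"
proof -
  \<comment> \<open>A step raises the expected value by at least
    \<open>gain j (real_part S) / m j\<close>, which pays for the coefficient growing from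
    \<open>t / m j\<close> to \<open>Suc t / m j\<close>.\<close>
  let ?h = "\<lambda>t S. f (real_part S) - (A (real_part S) + (real t / m j) * gain j (real_part S))"
  have "?h 0 S \<le> oc_expect f (group_loop i j S) (?h (q j))"
  proof (rule group_expect_ge[OF S j c])
    fix t S
    assume t: "t < q j" and S: "S \<in> states (c(j := c j + t))"
    let ?A = "\<lambda>R. A R + (real (Suc t) / m j) * gain j R"
    have c': "(c(j := c j + t)) j < m j"
      using c t by simp
    have A': "?A R' \<le> ?A R" if "R \<subseteq> R'" "R' \<subseteq> U" for R R'
      using A[OF that] gain_antimono[OF that] by (intro add_mono mult_left_mono) auto
    from step_antimono[where A = ?A, OF S j c' A', where i = i and t = "Suc t"]
      step_gain[OF S j c', where i = i and t = "Suc t"]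
    have "f (real_part S) + gain j (real_part S) / m j - ?A (real_part S)
      \<le> oc_expect f (step i j (Suc t) S) (\<lambda>S'. f (real_part S')) -
         oc_expect f (step i j (Suc t) S) (\<lambda>S'. ?A (real_part S'))"
      by linarith
    also have "\<dots> = oc_expect f (step i j (Suc t) S) (?h (Suc t))"
      by (rule oc_expect_diff[OF step_ensures[OF S j c'], symmetric])
    also have "f (real_part S) + gain j (real_part S) / m j - ?A (real_part S) = ?h t S"
      by (simp add: add_divide_distrib distrib_right)
    finally show "?h t S \<le> oc_expect f (step i j (Suc t) S) (?h (Suc t))" .
  qed
  also have "?h (q j) = (\<lambda>S'. f (real_part S') - (A (real_part S') + gain j (real_part S') / k))"
  \<comment> \<open>In general \<open>q j / m j = 1 / k\<close>. If \<open>q j = 0\<close>, this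
    quotient is \<open>0 / 0 = 0\<close> instead, but then \<open>OPT\<close> misses
    \<open>V j\<close> and the gain vanishes.\<close>
  proof (cases "q j = 0")
    case True
    then have "OPT \<inter> V j = {}"
      using OPT_card[OF j] finite_V[OF j] by simp
    then show ?thesis
      using True by (simp add: gain_def)
  qed (use m_eq[OF j] in simp)
  finally show ?thesis
    by simp
qed

lemma group_avoids:
  assumes S: "S \<in> states c" and j: "j \<in> {1..N}" and c: "c j + q j \<le> m j"
  shows "(1 - 1 / k) * of_bool (Inl x \<notin> S)
    \<le> oc_expect f (group_loop i j S) (\<lambda>S'. of_bool (Inl x \<notin> S'))"
proof -
  let ?r = "1 - 1 / real (m j)"
  \<comment> \<open>This covers \<open>m j = 0\<close>, where \<open>1 / 0 = 0\<close>.\<close>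
  have r: "0 \<le> ?r"
    by (simp add: divide_le_eq)
  \<comment> \<open>The exponent counts the remaining steps; each step uses up one factor.\<close>
  let ?h = "\<lambda>t S. ?r ^ (q j - t) * of_bool (Inl x \<notin> S)"
  \<comment> \<open>Bernoulli's inequality with \<open>q j / m j = 1 / k\<close>; for
    \<open>q j = 0\<close> the power is 1.\<close>
  have "1 - 1 / k \<le> ?r ^ q j"
  proof (cases "q j = 0")
    case False
    then have "1 - 1 / real k = 1 + of_nat (q j) * (- 1 / real (m j))"
      using m_eq[OF j] k_pos by simp
    also have "\<dots> \<le> (1 + (- 1 / real (m j))) ^ q j"
      using r by (intro Bernoulli_inequality) simp
    finally show ?thesis
      by simp
  qed simp
  then have "(1 - 1 / k) * of_bool (Inl x \<notin> S) \<le> ?h 0 S"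
    by (simp add: mult_right_mono)
  also have "\<dots> \<le> oc_expect f (group_loop i j S) (?h (q j))"
  proof (rule group_expect_ge[OF S j c])
    fix t S
    assume t: "t < q j" and S: "S \<in> states (c(j := c j + t))"
    have "?h t S = ?r ^ (q j - Suc t) * (?r * of_bool (Inl x \<notin> S))"
      using t by (simp add: Suc_diff_Suc flip: power_Suc2 mult.assoc)
    also have "\<dots> \<le> ?r ^ (q j - Suc t) *
        oc_expect f (step i j (Suc t) S) (\<lambda>S'. of_bool (Inl x \<notin> S'))"
      using c t by (intro mult_left_mono step_avoids[OF S j] zero_le_power[OF r]) simp
    also have "\<dots> = oc_expect f (step i j (Suc t) S) (?h (Suc t))"
      by (rule oc_expect_cmult[symmetric])
    finally show "?h t S \<le> oc_expect f (step i j (Suc t) S) (?h (Suc t))" .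
  qed
  finally show ?thesis
    by simp
qed

lemma group_avoids_other_group:
  assumes S: "S \<in> states c" and j: "j \<in> {1..N}" and c: "c j + q j \<le> m j"
    and x: "x \<in> V j'" "j' \<in> {1..N}" "j' \<noteq> j"
  shows "of_bool (Inl x \<notin> S) \<le> oc_expect f (group_loop i j S) (\<lambda>S'. of_bool (Inl x \<notin> S'))"
proof (rule group_expect_ge[OF S j c])
  fix t S
  assume "t < q j" and S: "S \<in> states (c(j := c j + t))"
  with c show "of_bool (Inl x \<notin> S) \<le> oc_expect f (step i j (Suc t) S) (\<lambda>S'. of_bool (Inl x \<notin> S'))"
    by (intro step_avoids_other_group[OF S j _ x]) simp
qed

section \<open>One round\<close>

text \<open>The situation after \<open>i\<close> full rounds and the first \<open>n\<close> groups
  of the next one.\<close>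

abbreviation round_states :: "nat \<Rightarrow> nat \<Rightarrow> 'a padded set set" where
  "round_states i n \<equiv> states (\<lambda>j. (if j \<le> n then Suc i else i) * q j)"

text \<open>From \<open>Suc i \<le> k\<close>. The conditional is left unevaluated to match the
  premise \<open>c j + q j \<le> m j\<close> of the group lemmas for the bounds in
  \<open>round_states\<close>.\<close>

lemma group_fits:
  assumes "i < k" "n < N"
  shows "(if Suc n \<le> n then Suc i else i) * q (Suc n) + q (Suc n) \<le> m (Suc n)"
  using mult_le_mono1[of "Suc i" k "q (Suc n)"] assms m_eq[of "Suc n"] by simp

text \<open>\<open>i'\<close> is the round counter that the selector sees, \<open>i\<close> the
  number of completed rounds; the bounds hold however ties are broken.\<close>

lemma group_in_round:
  assumes "i < k" "n < N" "S \<in> round_states i n"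
  shows "oc_ensures f (group_loop i' (Suc n) S) (round_states i (Suc n)) (q (Suc n) * (2 * card U))"
proof -
  let ?c = "\<lambda>j. (if j \<le> n then Suc i else i) * q j"
  have "?c(Suc n := ?c (Suc n) + q (Suc n)) = (\<lambda>j. (if j \<le> Suc n then Suc i else i) * q j)"
    by (auto simp: fun_eq_iff)
  then show ?thesis
    using group_ensures[OF assms(3) _ group_fits[OF assms(1,2)], of i'] assms(2) by simp
qed

lemma round_states_0: "round_states i 0 = states (\<lambda>j. i * q j)"
  by (rule states_cong) simp

lemma round_states_N: "round_states i N = states (\<lambda>j. Suc i * q j)"
  by (rule states_cong) simp

lemma round_ensures:
  assumes "i < k" "S \<in> states (\<lambda>j. i * q j)"
  shows "oc_ensures f (round_loop i' S) (states (\<lambda>j. Suc i * q j)) ((\<Sum>j=1..N. q j) * (2 * card U))"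
  using oc_ensures_for[where P = "round_states i" and n = N and body = "group_loop i'" and s = S
      and b = "\<lambda>j. q j * (2 * card U)" and f = f, OF group_in_round[OF assms(1)]] assms(2)
  unfolding round_loop_def round_states_0 round_states_N sum_distrib_right by blast

lemma round_expect_ge:
  assumes "i < k" "S \<in> states (\<lambda>j. i * q j)"
    and "\<And>n S. n < N \<Longrightarrow> S \<in> round_states i n \<Longrightarrow> h n S \<le> oc_expect f (group_loop i' (Suc n) S) (h (Suc n))"
  shows "h 0 S \<le> oc_expect f (round_loop i' S) (h N)"
  unfolding round_loop_def
  by (rule oc_expect_for_ge[where P = "round_states i" and b = "\<lambda>j. q j * (2 * card U)"])
    (use group_in_round assms round_states_0 in auto)

text \<open>All gains are evaluated at the end of the round, where they sum to at least
  \<open>f (OPT \<union> real_part S') - f (real_part S')\<close>. This makes the recurrence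
  implicit and puts the factor \<open>1 + 1 / k\<close> on the new value.\<close>

lemma round_gain:
  assumes i: "i < k" and S: "S \<in> states (\<lambda>j. i * q j)"
  shows "f (real_part S)
    \<le> oc_expect f (round_loop i' S) (\<lambda>S'. (1 + 1 / k) * f (real_part S') - f (OPT \<union> real_part S') / k)"
proof -
  let ?h = "\<lambda>n S. f (real_part S) - (\<Sum>j=1..n. gain j (real_part S)) / k"
  have "f (real_part S) = ?h 0 S"
    by simp
  also have "?h 0 S \<le> oc_expect f (round_loop i' S) (?h N)"
  proof (rule round_expect_ge[OF i S])
    fix n S
    assume n: "n < N" and S: "S \<in> round_states i n"
    \<comment> \<open>Here \<open>A\<close> is the sum of the gains of the first \<open>n\<close>
      groups divided by \<open>k\<close>.\<close>
    have "?h n S \<le> oc_expect f (group_loop i' (Suc n) S) (\<lambda>S'. f (real_part S') -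
        ((\<Sum>j=1..n. gain j (real_part S')) / k + gain (Suc n) (real_part S') / k))"
      by (rule group_gain[OF S _ group_fits[OF i n]])
        (use n in \<open>auto intro!: divide_right_mono sum_mono gain_antimono\<close>)
    then show "?h n S \<le> oc_expect f (group_loop i' (Suc n) S) (?h (Suc n))"
      by (simp add: add_divide_distrib)
  qed
  also have "\<dots> \<le> oc_expect f (round_loop i' S)
      (\<lambda>S'. (1 + 1 / k) * f (real_part S') - f (OPT \<union> real_part S') / k)"
  proof (rule oc_expect_mono[OF round_ensures[OF i S]])
    fix S'
    assume "S' \<in> states (\<lambda>j. Suc i * q j)"
    then have "f (OPT \<union> real_part S') - f (real_part S') \<le> (\<Sum>j=1..N. gain j (real_part S'))"
      by (intro union_OPT_le_sum_gain real_part_states)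
    then have "(f (OPT \<union> real_part S') - f (real_part S')) / k \<le> (\<Sum>j=1..N. gain j (real_part S')) / k"
      by (rule divide_right_mono) simp
    then show "?h N S' \<le> (1 + 1 / k) * f (real_part S') - f (OPT \<union> real_part S') / k"
      by (simp add: diff_divide_distrib distrib_right)
  qed
  finally show ?thesis .
qed

lemma round_avoids:
  assumes i: "i < k" and S: "S \<in> states (\<lambda>j. i * q j)" and x: "x \<in> U"
  shows "(1 - 1 / k) * of_bool (Inl x \<notin> S)
    \<le> oc_expect f (round_loop i' S) (\<lambda>S'. of_bool (Inl x \<notin> S'))"
proof -
  obtain j where j: "j \<in> {1..N}" "x \<in> V j"
    using x U_eq by auto
  \<comment> \<open>The factor is owed until group \<open>j\<close>, the only one that can draw
    \<open>x\<close>, has been processed.\<close>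
  let ?h = "\<lambda>n S. (if n < j then 1 - 1 / real k else 1) * of_bool (Inl x \<notin> S)"
  have "?h 0 S \<le> oc_expect f (round_loop i' S) (?h N)"
  proof (rule round_expect_ge[OF i S])
    fix n S
    assume n: "n < N" and S: "S \<in> round_states i n"
    have n': "Suc n \<in> {1..N}"
      using n by simp
    show "?h n S \<le> oc_expect f (group_loop i' (Suc n) S) (?h (Suc n))"
    proof (cases "Suc n = j")
      case True
      then show ?thesis
        using group_avoids[OF S n' group_fits[OF i n], of x i'] by simp
    next
      case False
      then have "n < j \<longleftrightarrow> Suc n < j"
        by auto
      then have "?h n S \<le> (if Suc n < j then 1 - 1 / real k else 1) *
          oc_expect f (group_loop i' (Suc n) S) (\<lambda>S'. of_bool (Inl x \<notin> S'))"
        using False k_pos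
        by (simp only:, intro mult_left_mono group_avoids_other_group[OF S n' group_fits[OF i n] j(2,1)])
          auto
      then show ?thesis
        unfolding oc_expect_cmult .
    qed
  qed
  then show ?thesis
    using j(1) by simp
qed

section \<open>All rounds and the recurrence\<close>

lemma run_ensures:
  assumes "n \<le> k"
  shows "oc_ensures f (run n) (states (\<lambda>j. n * q j)) (n * ((\<Sum>j=1..N. q j) * (2 * card U)))"
proof -
  have "oc_ensures f (run n) (states (\<lambda>j. n * q j)) (\<Sum>i=1..n. (\<Sum>j=1..N. q j) * (2 * card U))"
    unfolding run_def
    by (rule oc_ensures_for[where P = "\<lambda>i. states (\<lambda>j. i * q j)"])
      (use round_ensures assms in \<open>auto simp: states_def\<close>)
  then show ?thesis
    by simp
qed

lemma run_Suc_expect: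
  assumes "n < k"
  shows "oc_expect f (run (Suc n)) h = oc_expect f (run n) (\<lambda>S. oc_expect f (round_loop (Suc n) S) h)"
  unfolding run_def upt_1_Suc_Suc oc_for_snoc
  by (rule oc_expect_bind[OF run_ensures[of n, unfolded run_def] round_ensures]) (use assms in auto)

lemma run_avoids:
  assumes "n \<le> k" "x \<in> U"
  shows "(1 - 1 / k) ^ n \<le> oc_expect f (run n) (\<lambda>S. of_bool (Inl x \<notin> S))"
  using assms(1)
proof (induction n)
  case 0
  then show ?case
    by (simp add: run_def oc_expect_return)
next
  case (Suc n)
  have "(1 - 1 / real k) ^ Suc n \<le> (1 - 1 / k) * oc_expect f (run n) (\<lambda>S. of_bool (Inl x \<notin> S))"
    using Suc k_pos by (auto intro: mult_left_mono)
  also have "\<dots> = oc_expect f (run n) (\<lambda>S. (1 - 1 / k) * of_bool (Inl x \<notin> S))"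
    by (rule oc_expect_cmult[symmetric])
  also have "\<dots> \<le> oc_expect f (run n)
      (\<lambda>S. oc_expect f (round_loop (Suc n) S) (\<lambda>S'. of_bool (Inl x \<notin> S')))"
    using Suc.prems assms(2)
    by (intro oc_expect_mono[OF run_ensures] round_avoids[where i = n]) auto
  also have "\<dots> = oc_expect f (run (Suc n)) (\<lambda>S. of_bool (Inl x \<notin> S))"
    using Suc.prems by (intro run_Suc_expect[symmetric]) simp
  finally show ?case .
qed

text \<open>By \<open>run_avoids\<close> each element is selected with probability at most
  \<open>1 - (1 - 1 / k) ^ n\<close>. The random subset bound applies although the selections depend
  on each other.\<close>

lemma run_union_OPT:
  assumes "n \<le> k"
  shows "(1 - 1 / k) ^ n * f OPT \<le> oc_expect f (run n) (\<lambda>S. f (OPT \<union> real_part S))"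
proof -
  let ?\<mu> = "map_pmf (\<lambda>z. real_part (fst z)) (run n f)"
  let ?p = "1 - (1 - 1 / real k) ^ n"
  have ens: "oc_ensures f (run n) (states (\<lambda>j. n * q j)) (n * ((\<Sum>j=1..N. q j) * (2 * card U)))"
    by (rule run_ensures[OF assms])
  have "(1 - ?p) * f (OPT \<union> {}) \<le> measure_pmf.expectation ?\<mu> (\<lambda>A. f (OPT \<union> A))"
  proof (rule submodular_on_expectation_random_subset_ge[OF finite_U])
    show "submodular_on U (\<lambda>A. f (OPT \<union> A))"
      by (rule submodular_on_union_left[OF submod OPT_subset])
    show "0 \<le> f (OPT \<union> A)" if "A \<subseteq> U" for A
      using that OPT_subset by (intro nonneg) auto
    show "set_pmf ?\<mu> \<subseteq> Pow U"
      using ens by (force simp: oc_ensures_def dest: real_part_states)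
    show "0 \<le> ?p"
      using k_pos by (simp add: power_le_one)
    fix x
    assume "x \<in> U"
    have "measure_pmf.prob ?\<mu> {A. x \<in> A} = measure_pmf.expectation ?\<mu> (indicator {A. x \<in> A})"
      by simp
    also have "\<dots> = oc_expect f (run n) (\<lambda>S. of_bool (Inl x \<in> S))"
      unfolding integral_map_pmf oc_expect_def
      by (intro Bochner_Integration.integral_cong) (auto simp: indicator_def)
    also have "\<dots> = oc_expect f (run n) (\<lambda>S. 1 - of_bool (Inl x \<notin> S))"
      by (intro arg_cong[of _ _ "oc_expect f (run n)"]) auto
    also have "\<dots> = 1 - oc_expect f (run n) (\<lambda>S. of_bool (Inl x \<notin> S))"
      unfolding oc_expect_diff[OF ens] by (simp add: oc_expect_def split_def)
    also have "\<dots> \<le> ?p"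
      using run_avoids[OF assms \<open>x \<in> U\<close>] by simp
    finally show "measure_pmf.prob ?\<mu> {A. x \<in> A} \<le> ?p" .
  qed
  then show ?thesis
    by (simp add: oc_expect_def split_def)
qed

text \<open>With \<open>r = 1 - 1 / k\<close> and \<open>a n\<close> the expected value after
  \<open>n\<close> rounds, a round gives
  \<open>a n + r ^ Suc n * f OPT / k \<le> (1 + 1 / k) * a (Suc n)\<close>. The bound is propagated
  because \<open>r * (1 + 1 / k) = 1 - 1 / k^2 \<le> 1\<close> and
  \<open>(1 + 1 / k) / (k + 1) = 1 / k\<close>.\<close>

lemma run_value:
  assumes "n \<le> k"
  shows "real n / (real k + 1) * (1 - 1 / k) ^ n * f OPT \<le> oc_expect f (run n) (\<lambda>S. f (real_part S))"
  using assms
proof (induction n)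
  case 0
  show ?case
    using nonneg[of "{}"] by (simp add: run_def oc_expect_return real_part_def)
next
  case (Suc n)
  let ?r = "1 - 1 / real k"
  let ?a = "\<lambda>n. oc_expect f (run n) (\<lambda>S. f (real_part S))"
  have n: "n < k"
    using Suc.prems by simp
  note ens = run_ensures[OF Suc.prems]
  have "?a n \<le> oc_expect f (run n) (\<lambda>S. oc_expect f (round_loop (Suc n) S)
      (\<lambda>S'. (1 + 1 / k) * f (real_part S') - f (OPT \<union> real_part S') / k))"
    using n by (intro oc_expect_mono[OF run_ensures] round_gain[where i = n]) auto
  also have "\<dots> = oc_expect f (run (Suc n))
      (\<lambda>S'. (1 + 1 / k) * f (real_part S') - 1 / k * f (OPT \<union> real_part S'))"
    by (subst run_Suc_expect[OF n]) simp
  also have "\<dots> = (1 + 1 / k) * ?a (Suc n) - 1 / k * oc_expect f (run (Suc n)) (\<lambda>S. f (OPT \<union> real_part S))"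
    unfolding oc_expect_diff[OF ens] oc_expect_cmult ..
  also have "\<dots> \<le> (1 + 1 / k) * ?a (Suc n) - 1 / k * (?r ^ Suc n * f OPT)"
    using run_union_OPT[OF Suc.prems] by (intro diff_left_mono mult_left_mono) auto
  finally have recur: "?a n + 1 / k * (?r ^ Suc n * f OPT) \<le> (1 + 1 / k) * ?a (Suc n)"
    by simp
  have F: "0 \<le> ?r ^ n * f OPT"
    using nonneg[OF OPT_subset] k_pos by simp
  have "real n / (real k + 1) * (?r * (1 + 1 / k)) * (?r ^ n * f OPT) \<le> real n / (real k + 1) * 1 * (?r ^ n * f OPT)"
    using k_pos by (intro mult_right_mono[OF _ F] mult_left_mono) (auto simp: field_simps)
  also have "\<dots> \<le> ?a n"
    using Suc n by simp
  finally have IH: "real n / (real k + 1) * (?r * (1 + 1 / k)) * (?r ^ n * f OPT) \<le> ?a n" .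
  \<comment> \<open>Splitting \<open>Suc n = n + 1\<close> separates what the induction hypothesis
    covers from the contribution of the new round.\<close>
  have "(1 + 1 / k) * (real (Suc n) / (real k + 1) * ?r ^ Suc n * f OPT)
      = real n / (real k + 1) * (?r * (1 + 1 / k)) * (?r ^ n * f OPT)
        + (1 + 1 / k) / (real k + 1) * (?r ^ Suc n * f OPT)"
    by (simp add: add_divide_distrib algebra_simps)
  also have "(1 + 1 / k) / (real k + 1) = 1 / real k"
  proof -
    have "real k + 1 \<noteq> 0" "real k \<noteq> 0"
      using k_pos by linarith+
    then show ?thesis
      by (simp add: divide_simps)
  qed
  also have "real n / (real k + 1) * (?r * (1 + 1 / k)) * (?r ^ n * f OPT) + 1 / k * (?r ^ Suc n * f OPT)
      \<le> (1 + 1 / k) * ?a (Suc n)"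
    using IH recur by linarith
  finally show ?case
    by (rule mult_left_le_imp_le) (use k_pos in \<open>simp add: add_pos_nonneg\<close>)
qed

text \<open>The estimate of \<open>(1 - 1 / k) ^ k\<close> leaves a loss of
  \<open>2 / ((k + 1) * exp 1)\<close>, which is rounded up to \<open>2 / k\<close>, the
  \<open>\<epsilon>\<close> of the algorithm.\<close>

lemma run_value_k: "(1 / exp 1 - 2 / k) * f OPT \<le> oc_expect f (run k) (\<lambda>S. f (real_part S))"
proof -
  have "1 / exp 1 - 2 / real k \<le> 1 / exp 1 - 2 / (real k + 1) * (1 / exp 1)"
  proof -
    have "2 / (real k + 1) * (1 / exp 1) \<le> 2 / k * 1"
      using k_pos by (intro mult_mono divide_left_mono) auto
    then show ?thesis
      by simp
  qed
  also have "\<dots> = (1 - 2 / (real k + 1)) / exp 1"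
    by (simp add: diff_divide_distrib)
  also have "1 - 2 / (real k + 1) = real k / (real k + 1) * (1 - 1 / k)"
  proof -
    have "real k + 1 \<noteq> 0" "real k \<noteq> 0"
      using k_pos by linarith+
    then show ?thesis
      by (simp add: divide_simps)
  qed
  also have "real k / (real k + 1) * (1 - 1 / k) / exp 1 = real k / (real k + 1) * ((1 - 1 / k) / exp 1)"
    by simp
  also have "\<dots> \<le> real k / (real k + 1) * (1 - 1 / k) ^ k"
    using one_minus_inverse_power_ge[OF k_pos] by (intro mult_left_mono) auto
  finally have "(1 / exp 1 - 2 / k) * f OPT \<le> real k / (real k + 1) * (1 - 1 / k) ^ k * f OPT"
    using nonneg[OF OPT_subset] by (intro mult_right_mono) auto
  also have "\<dots> \<le> oc_expect f (run k) (\<lambda>S. f (real_part S))"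
    by (rule run_value) simp
  finally show ?thesis .
qed

section \<open>Transfer to the algorithm\<close>

lemma card_real_part_Int:
  assumes "S \<in> states c" "j \<in> {1..N}"
  shows "card (real_part S \<inter> V j) \<le> c j"
proof -
  have "card (real_part S \<inter> V j) = card (Inl ` (real_part S \<inter> V j) :: 'a padded set)"
    by (simp add: card_image)
  also have "\<dots> \<le> card (S \<inter> W j)"
    using finite_W[OF assms(2)] by (intro card_mono) auto
  also have "\<dots> \<le> c j"
    using assms by (simp add: states_def)
  finally show ?thesis .
qed

end

text \<open>The constant 4 comes from \<open>2 / \<epsilon>\<close> rounds of \<open>v\<close> steps
  with at most \<open>2 * card U\<close> queries each.\<close>

lemma nonmono_bi_guarantees:
  fixes f :: "'a set \<Rightarrow> real" and p :: "nat \<Rightarrow> real" and v :: nat and \<epsilon> :: real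
  assumes base: "finite U" "submodular_on U f" "\<forall>A \<subseteq> U. f A \<ge> 0"
      "(\<Union>j\<in>{1..N}. V j) = U" "disjoint_family_on V {1..N}"
      "\<forall>i j t S. top_selector (sel i j t S)"
    and sum_p: "(\<Sum>j\<in>{1..N}. p j) = 1"
    and \<epsilon>: "\<epsilon> > 0" and k_Nats: "2 / \<epsilon> \<in> \<nat>"
    and q_Nats: "\<forall>j\<in>{1..N}. p j * real v \<in> \<nat>"
    and OPT: "is_arg_max f (\<lambda>T. T \<subseteq> U \<and> (\<forall>j\<in>{1..N}. real (card (T \<inter> V j)) \<le> p j * real v)) OPT"
  shows "measure_pmf.expectation (nonmono_bi sel N V p v \<epsilon> f) (\<lambda>(S, queries). f S)
        \<ge> (1 / exp 1 - \<epsilon>) * f OPT \<and>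
    (\<forall>(S, queries) \<in> set_pmf (nonmono_bi sel N V p v \<epsilon> f).
        (\<forall>j\<in>{1..N}. real (card (S \<inter> V j)) \<le> 2 / \<epsilon> * p j * real v) \<and>
        real queries \<le> 4 * (real (card U) * real v / \<epsilon>))"
proof (intro conjI)
  define k where "k = nat \<lfloor>2 / \<epsilon>\<rfloor>"
  define q where "q = (\<lambda>j. nat \<lfloor>p j * real v\<rfloor>)"
  define m where "m = (\<lambda>j. nat \<lfloor>2 * p j * real v / \<epsilon>\<rfloor>)"
  \<comment> \<open>By integrality the floors in the algorithm are exact.\<close>
  have k: "real k = 2 / \<epsilon>"
    using k_Nats unfolding k_def by (auto elim!: Nats_cases)
  have q: "real (q j) = p j * real v" if "j \<in> {1..N}" for j
    using bspec[OF q_Nats that] unfolding q_def by (auto elim!: Nats_cases)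
  have m: "m j = k * q j" if "j \<in> {1..N}" for j
  proof -
    have "2 * p j * real v / \<epsilon> = real (k * q j)"
      using k q[OF that] by simp
    then show ?thesis
      unfolding m_def by (simp only: floor_of_nat nat_int)
  qed
  have "card (OPT \<inter> V j) \<le> q j" if "j \<in> {1..N}" for j
  proof -
    have "real (card (OPT \<inter> V j)) \<le> p j * real v"
      using OPT that unfolding is_arg_max_def by blast
    then show ?thesis
      using q[OF that] by linarith
  qed
  moreover have "0 < k"
    using k \<epsilon> by (metis divide_pos_pos of_nat_0_less_iff zero_less_numeral)
  ultimately interpret padded_instance f U N V q m k OPT sel
    using base OPT m by unfold_locales (auto simp: is_arg_max_def)
  have alg: "nonmono_bi sel N V p v \<epsilon> = oc_bind (run k) (\<lambda>S. oc_return (real_part S))"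
    unfolding nonmono_bi_def run_def round_loop_def[abs_def] group_loop_def[abs_def] step_def[abs_def]
      Let_def
    unfolding k_def q_def m_def ..
  note run = run_ensures[OF order_refl]
  have "2 / real k = \<epsilon>"
    using k \<epsilon> by simp
  moreover have "oc_expect f (nonmono_bi sel N V p v \<epsilon>) f = oc_expect f (run k) (\<lambda>S. f (real_part S))"
    unfolding alg by (subst oc_expect_bind[OF run oc_ensures_return[OF UNIV_I]]) (simp add: oc_expect_return)
  ultimately show "(1 / exp 1 - \<epsilon>) * f OPT
      \<le> measure_pmf.expectation (nonmono_bi sel N V p v \<epsilon> f) (\<lambda>(S, queries). f S)"
    using run_value_k by (simp add: oc_expect_def)
  \<comment> \<open>As the \<open>p j\<close> sum to 1, a round consists of exactly \<open>v\<close>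
    steps.\<close>
  have "real (\<Sum>j=1..N. q j) = (\<Sum>j=1..N. p j) * real v"
    using q by (simp add: sum_distrib_right)
  then have "real (\<Sum>j=1..N. q j) = real v"
    by (simp only: sum_p mult_1)
  then have qv: "(\<Sum>j=1..N. q j) = v"
    by (simp only: of_nat_eq_iff)
  have "oc_ensures f (nonmono_bi sel N V p v \<epsilon>) (real_part ` states (\<lambda>j. k * q j))
      (k * ((\<Sum>j=1..N. q j) * (2 * card U)) + 0)"
    unfolding alg by (intro oc_ensures_bind[OF run] oc_ensures_return imageI)
  then have out: "S \<in> real_part ` states (\<lambda>j. k * q j)" "queries \<le> k * (v * (2 * card U))"
    if "(S, queries) \<in> set_pmf (nonmono_bi sel N V p v \<epsilon> f)" for S queries
    using that qv by (auto simp: oc_ensures_def)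
  show "\<forall>(S, queries) \<in> set_pmf (nonmono_bi sel N V p v \<epsilon> f).
        (\<forall>j\<in>{1..N}. real (card (S \<inter> V j)) \<le> 2 / \<epsilon> * p j * real v) \<and>
        real queries \<le> 4 * (real (card U) * real v / \<epsilon>)"
  proof (rule ballI, unfold split_paired_all prod.case, intro conjI ballI)
    fix S queries
    assume mem: "(S, queries) \<in> set_pmf (nonmono_bi sel N V p v \<epsilon> f)"
    show "real (card (S \<inter> V j)) \<le> 2 / \<epsilon> * p j * real v" if j: "j \<in> {1..N}" for j
    proof -
      have "card (S \<inter> V j) \<le> k * q j"
        using out(1)[OF mem] card_real_part_Int[OF _ j] by blast
      then have "real (card (S \<inter> V j)) \<le> real k * real (q j)"
        by (metis of_nat_le_iff of_nat_mult)
      then show ?thesis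
        using k q[OF j] by simp
    qed
    have "real queries \<le> real k * (real v * (2 * real (card U)))"
      using out(2)[OF mem] by (metis of_nat_le_iff of_nat_mult of_nat_numeral)
    then show "real queries \<le> 4 * (real (card U) * real v / \<epsilon>)"
      by (simp add: k mult_ac)
  qed
qed

theorem theorem2:
  shows "\<exists>C > 0. \<forall>(f :: 'a set \<Rightarrow> real) U N V p v \<epsilon> OPT sel.
    finite U \<and> submodular_on U f \<and> (\<forall>A \<subseteq> U. f A \<ge> 0) \<and>
    (\<Union>j\<in>{1..N}. V j) = U \<and> disjoint_family_on V {1..N} \<and>
    (\<forall>j\<in>{1..N}. 0 \<le> p j \<and> p j \<le> 1) \<and> (\<Sum>j\<in>{1..N}. p j) = 1 \<and>
    \<epsilon> > 0 \<and> 2 / \<epsilon> \<in> \<nat> \<and> (\<forall>j\<in>{1..N}. p j * real v \<in> \<nat>) \<and>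
    (\<forall>i j t S. top_selector (sel i j t S)) \<and>
    is_arg_max f (\<lambda>T. T \<subseteq> U \<and> (\<forall>j\<in>{1..N}. real (card (T \<inter> V j)) \<le> p j * real v)) OPT
    \<longrightarrow>
    measure_pmf.expectation (nonmono_bi sel N V p v \<epsilon> f) (\<lambda>(S, queries). f S)
        \<ge> (1 / exp 1 - \<epsilon>) * f OPT \<and>
    (\<forall>(S, queries) \<in> set_pmf (nonmono_bi sel N V p v \<epsilon> f).
        (\<forall>j\<in>{1..N}. real (card (S \<inter> V j)) \<le> 2 / \<epsilon> * p j * real v) \<and>
        real queries \<le> C * (real (card U) * real v / \<epsilon>))"
proof (rule exI[of _ 4], rule conjI)
  show "(0::real) < 4"
    by simp
qed (intro allI impI, elim conjE, rule nonmono_bi_guarantees; assumption)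

end
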